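(* For every integer $d \ge 2$, there exists a graph $G$ and a partition $\mathcal{P} = \{V_1, \ldots, V_r\}$ of $V(G)$ such that $G$ has maximum degree $d$, $|V_i| \ge d+1$ for every $i$, the following two conditions hold, and $G$ has no independent transversal with respect to $\mathcal{P}$: (a) for every connected component $C$ of $G$, every block of $\mathcal{P}$ contains at most one vertex of $C$ (that is, $G$ has multiplicity $1$ with respect to $\mathcal{P}$); (b) for every two connected components $C, C'$ of $G$, two blocks $V_i, V_j$ of $\mathcal{P}$, and vertices $v \in C \cap V_i$, $w \in C \cap V_j$, $v' \in C' \cap V_i$, $w' \in C' \cap V_j$, the vertices $v$ and $w$ are adjacent in $C$ if and only if $v'$ and $w'$ are adjacent in $C'$.
   Context: For a graph $G$ and a partition $\mathcal{P} = \{V_1, \ldots, V_r\}$ of its vertex set $V(G)$ into blocks (partition classes) $V_i$, an independent transversal (IT) of $G$ with respect to $\mathcal{P}$ is an independent set $\{v_1, \ldots, v_r\}$ of $G$ such that $v_i \in V_i$ for every $i \in \{1, \ldots, r\}$. The multiplicity of $G$ with respect to $\mathcal{P}$ is the maximum, over all connected components $C$ of $G$ and blocks $V_i \in \mathcal{P}$, of the number of vertices in $C \cap V_i$. *)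

theory Defs
  imports "Graph_Theory.Digraph_Component" "HOL-Library.Disjoint_Sets"
begin

text \<open>
  Finite simple graphs are the symmetric, loopless digraphs without parallel arcs of the
  locale \<^locale>\<open>graph\<close>. Every undirected edge is a pair of opposite arcs, so the degree of a
  vertex is its out-degree and \<open>dominates\<close> (written with an arrow) is adjacency.
\<close>

text \<open>Meaningful for finite graphs with at least one vertex.\<close>

definition max_degree :: "('a, 'b) pre_digraph \<Rightarrow> nat" where
  "max_degree G = Max (out_degree G ` verts G)"

definition connected_components :: "('a, 'b) pre_digraph \<Rightarrow> ('a, 'b) pre_digraph set" where
  "connected_components G = {C. pre_digraph.max_subgraph G Digraph_Component.connected C}"

definition independent_set :: "('a, 'b) pre_digraph \<Rightarrow> 'a set \<Rightarrow> bool" where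
  "independent_set G I \<longleftrightarrow> I \<subseteq> verts G \<and> (\<forall>v\<in>I. \<forall>w\<in>I. \<not> v \<rightarrow>\<^bsub>G\<^esub> w)"

text \<open>The choice function \<open>f\<close> sends the block $V_i$ to its representative $v_i$.\<close>

definition independent_transversal ::
    "('a, 'b) pre_digraph \<Rightarrow> 'a set set \<Rightarrow> 'a set \<Rightarrow> bool" where
  "independent_transversal G P I \<longleftrightarrow>
     independent_set G I \<and> (\<exists>f. (\<forall>B\<in>P. f B \<in> B) \<and> I = f ` P)"

definition multiplicity :: "('a, 'b) pre_digraph \<Rightarrow> 'a set set \<Rightarrow> nat" where
  "multiplicity G P = Max {card (verts C \<inter> B) | C B. C \<in> connected_components G \<and> B \<in> P}"

text \<open>In a symmetric digraph these are the strongly connected components.\<close>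

lemma (in graph) connected_components_eq_sccs: "connected_components G = sccs"
proof -
  have mono: "arc_mono (Digraph_Component.connected :: ('a, 'b) pre_digraph \<Rightarrow> bool)"
    unfolding arc_mono_def
  proof (intro allI impI, elim conjE)
    fix H1 H2 :: "('a, 'b) pre_digraph"
    assume conn: "Digraph_Component.connected H1" and sub: "subgraph H1 H2"
      and same: "verts H1 = verts H2"
    have "(arcs_ends H1)\<^sup>s \<subseteq> (arcs_ends H2)\<^sup>s"
      using arcs_ends_mono[OF sub] by (auto simp: symcl_def)
    then have "rtrancl_on (verts H2) ((arcs_ends H1)\<^sup>s) \<subseteq> rtrancl_on (verts H2) ((arcs_ends H2)\<^sup>s)"
      by (auto intro: rtrancl_on_mono)
    then show "Digraph_Component.connected H2"
      using conn same by (auto simp: connected_conv)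
  qed
  have sc: "strongly_connected H" if "induced_subgraph H G" "Digraph_Component.connected H" for H
  proof -
    interpret H: wf_digraph H using that by auto
    show ?thesis
      using that induced_graph_imp_symmetric[OF sym_arcs that(1)]
      by (intro H.symmetric_connected_imp_strongly_connected)
  qed
  have conn: "Digraph_Component.connected H" if "subgraph H G" "strongly_connected H" for H
  proof -
    interpret H: wf_digraph H using that by auto
    show ?thesis using that(2)
      by (auto simp: Digraph_Component.connected_def strongly_connected_def intro: H.reachable_mk_symmetricI)
  qed
  have "max_subgraph Digraph_Component.connected H \<longleftrightarrow> max_subgraph strongly_connected H"
    (is "?L \<longleftrightarrow> ?R") for H
  proof
    assume L: ?L
    then have "induced_subgraph H G" by (rule induced_subgraphI_arc_mono[OF _ mono])
    then show ?R using L sc conn unfolding max_subgraph_def by blast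
  next
    assume R: ?R
    then have H: "subgraph H G" "strongly_connected H" by (auto simp: max_subgraph_def)
    have "H' = H" if "subgraph H H'" "subgraph H' G" "Digraph_Component.connected H'" for H'
    proof -
      let ?I = "G \<restriction> verts H'"
      have I: "subgraph H' ?I" "induced_subgraph ?I G"
        using that by (auto intro: subgraph_induce_subgraphI2 induced_induce)
      have "Digraph_Component.connected ?I"
        using mono I(1) that(3) unfolding arc_mono_def by fastforce
      then have "strongly_connected ?I" using I(2) by (rule sc[rotated])
      moreover have "subgraph H ?I" using that(1) I(1) by (rule subgraph_trans)
      moreover have "subgraph ?I G" using I(2) by auto
      ultimately have "?I = H" using R unfolding max_subgraph_def by blast
      then show ?thesis using that(1) I(1) by (auto simp: subgraph_def compatible_def intro!: pre_digraph.equality)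
    qed
    then show ?L using H conn unfolding max_subgraph_def by blast
  qed
  then show ?thesis
    by (simp add: connected_components_def sccs_altdef2)
qed

end

theory Submission
  imports Defs "HOL-Library.Countable"
begin

text \<open>
  Proper list colourings of a graph on the blocks are exactly the independent transversals of the
  graph on pairs (block, colour) in which each colour class carries a copy of the block graph, and
  conditions (a) and (b) hold for every such graph. So it suffices to find a non-colourable
  graph with lists of size \<open>d + 1\<close> in which every vertex has at most \<open>d\<close> neighbours sharing
  any given colour of its list (Bohman and Holzman).

  If the \<open>d + 1\<close> cells of a clique have the colours \<open>0, \<dots>, d\<close> in their lists, except that for
  the last cell the colour \<open>0\<close> is replaced by an exit colour, and a hub outside the clique is
  joined to it and uses colour \<open>0\<close>, then the last cell must use its exit colour. Each of four hubs
  is attached to \<open>d + 1\<close> such cliques, one per colour of the hub, so every hub activates one of its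
  \<open>d + 1\<close> exits. The hubs come in two pairs. Within a pair, the first \<open>d\<close> exits of one hub are
  completely joined to the first \<open>d\<close> exits of the other, so some hub of each pair activates its
  last exit; but the last exits of one pair are joined to those of the other.
\<close>

section \<open>From list colourings to independent transversals\<close>

text \<open>A walk inside the component joins \<open>v\<close> to \<open>w\<close>, and
  \<open>k\<close> is unchanged along every arc. The intended \<open>k\<close> is the colour of a
  vertex.\<close>

lemma sccs_fun_eq:
  assumes C: "C \<in> pre_digraph.sccs G" "v \<in> verts C" "w \<in> verts C"
    and inv: "\<And>x y. x \<rightarrow>\<^bsub>G\<^esub> y \<Longrightarrow> k x = k y"
  shows "k v = k w"
proof -
  have sub: "subgraph C G" and "strongly_connected C"
    using C(1) by (auto simp: pre_digraph.sccs_def)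
  then have "v \<rightarrow>\<^sup>*\<^bsub>C\<^esub> w" using C(2,3) by auto
  interpret C: wf_digraph C using sub by (simp add: subgraph_def)
  show ?thesis using \<open>v \<rightarrow>\<^sup>*\<^bsub>C\<^esub> w\<close>
  proof (induction rule: C.reachable_induct)
    case base
    show ?case ..
  next
    case (step x y)
    then show ?case using inv arcs_ends_mono[OF sub] by (metis subsetD)
  qed
qed

lemma induced_subgraph_dominates_iff:
  assumes "induced_subgraph C G" "v \<in> verts C" "w \<in> verts C"
  shows "v \<rightarrow>\<^bsub>C\<^esub> w \<longleftrightarrow> v \<rightarrow>\<^bsub>G\<^esub> w"
proof -
  have "tail C = tail G" "head C = head G"
    and "arcs C = {e \<in> arcs G. tail G e \<in> verts C \<and> head G e \<in> verts C}"
    using assms(1) by (auto simp: induced_subgraph_def subgraph_def compatible_def)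
  then show ?thesis using assms(2,3) by (auto simp: arcs_ends_conv)
qed

locale list_assignment =
  fixes X :: "'b::countable set" and L :: "'b \<Rightarrow> 'c::countable set" and H :: "'b \<Rightarrow> 'b \<Rightarrow> bool"
  assumes finite_X: "finite X" and finite_L: "b \<in> X \<Longrightarrow> finite (L b)"
    and H_sym: "H b b' \<Longrightarrow> H b' b" and H_irrefl: "\<not> H b b"
begin

text \<open>Coded as naturals because the final statement fixes the vertex type to
  \<open>nat\<close>.\<close>

definition node :: "'b \<Rightarrow> 'c \<Rightarrow> nat" where
  "node b c = to_nat (b, c)"

lemma node_eq_iff [simp]: "node b c = node b' c' \<longleftrightarrow> b = b' \<and> c = c'"
  by (simp add: node_def)

definition G :: "(nat, nat \<times> nat) pre_digraph" where
  "G = \<lparr>verts = {node b c |b c. b \<in> X \<and> c \<in> L b},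
    arcs = {(node b c, node b' c) |b b' c. b \<in> X \<and> b' \<in> X \<and> c \<in> L b \<and> c \<in> L b' \<and> H b b'},
    tail = fst, head = snd\<rparr>"

definition block :: "'b \<Rightarrow> nat set" where
  "block b = node b ` L b"

lemma node_in_verts: "node b c \<in> verts G \<longleftrightarrow> b \<in> X \<and> c \<in> L b"
  by (auto simp: G_def)

lemma dominates_iff:
  "v \<rightarrow>\<^bsub>G\<^esub> w \<longleftrightarrow>
    (\<exists>b b' c. v = node b c \<and> w = node b' c \<and> b \<in> X \<and> b' \<in> X \<and> c \<in> L b \<and> c \<in> L b' \<and> H b b')"
  by (auto simp: G_def arcs_ends_conv image_iff)

lemma node_dominates_iff:
  "node b c \<rightarrow>\<^bsub>G\<^esub> node b' c' \<longleftrightarrow> c = c' \<and> b \<in> X \<and> b' \<in> X \<and> c \<in> L b \<and> c \<in> L b' \<and> H b b'"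
  by (auto simp: dominates_iff)

lemma graph_G: "graph G"
proof unfold_locales
  have "verts G = (\<lambda>(b, c). node b c) ` Sigma X L" by (force simp: G_def)
  then show fin: "finite (verts G)" using finite_X finite_L by (simp add: finite_SigmaI)
  have "arcs G \<subseteq> verts G \<times> verts G" by (auto simp: G_def)
  then show "finite (arcs G)" using fin finite_subset by blast
  show "symmetric G"
    unfolding symmetric_def by (rule symI) (auto simp: dominates_iff intro: H_sym)
qed (auto simp: G_def arc_to_ends_def H_irrefl)

lemma out_degree_node:
  assumes "b \<in> X" "c \<in> L b"
  shows "out_degree G (node b c) = card {b'\<in>X. H b b' \<and> c \<in> L b'}"
proof -
  have "out_arcs G (node b c) = (\<lambda>b'. (node b c, node b' c)) ` {b'\<in>X. H b b' \<and> c \<in> L b'}"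
    using assms by (auto simp: out_arcs_def G_def)
  moreover have "inj_on (\<lambda>b'. (node b c, node b' c)) A" for A by (simp add: inj_on_def)
  ultimately show ?thesis by (simp add: out_degree_def card_image)
qed

lemma partition_on_blocks:
  assumes "\<And>b. b \<in> X \<Longrightarrow> L b \<noteq> {}"
  shows "partition_on (verts G) (block ` X)"
  using assms by (intro partition_onI) (auto simp: G_def block_def disjnt_def)

lemma card_block: "card (block b) = card (L b)"
  by (simp add: block_def card_image inj_on_def)

lemma component_induced: "C \<in> connected_components G \<Longrightarrow> induced_subgraph C G"
  using graph.connected_components_eq_sccs[OF graph_G] by (simp add: pre_digraph.in_sccs_imp_induced)

lemma component_colour_eq:
  assumes C: "C \<in> connected_components G" and "node b c \<in> verts C" "node b' c' \<in> verts C"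
  shows "c = c'"
proof -
  have scc: "C \<in> pre_digraph.sccs G"
    using C graph.connected_components_eq_sccs[OF graph_G] by simp
  \<comment> \<open>Decoding recovers the colour, and every arc of \<open>G\<close> stays within one
    colour.\<close>
  have "snd (from_nat (node b c) :: 'b \<times> 'c) = snd (from_nat (node b' c') :: 'b \<times> 'c)"
    by (rule sccs_fun_eq[OF scc assms(2,3)]) (auto simp: dominates_iff node_def)
  then show ?thesis by (simp add: node_def)
qed

lemma component_Int_block_le_1:
  assumes "C \<in> connected_components G"
  shows "card (verts C \<inter> block b) \<le> 1"
proof -
  have "verts C \<inter> block b \<subseteq> {v}" if "v \<in> verts C \<inter> block b" for v
    using that component_colour_eq[OF assms] by (auto simp: block_def)
  then show ?thesis
    by (metis card.empty card_mono finite.emptyI finite.insertI is_singletonI is_singleton_altdef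
        ex_in_conv zero_le)
qed

lemma multiplicity_eq_1:
  assumes b: "b \<in> X" "c \<in> L b"
  shows "multiplicity G (block ` X) = 1"
proof -
  interpret graph G by (rule graph_G)
  let ?M = "{card (verts C \<inter> B) |C B. C \<in> connected_components G \<and> B \<in> block ` X}"
  have le: "?M \<subseteq> {..1}" using component_Int_block_le_1 by auto
  have v: "node b c \<in> verts G" using b by (simp add: node_in_verts)
  \<comment> \<open>The component of an arbitrary node shows that the upper bound 1 is
    attained.\<close>
  let ?C = "G \<restriction> {w. node b c \<rightarrow>\<^sup>*\<^bsub>G\<^esub> w}"
  have C: "?C \<in> connected_components G"
    using v by (simp add: connected_components_eq_sccs induce_reachable_is_in_sccs)
  moreover have "node b c \<in> verts ?C \<inter> block b" using b v by (simp add: block_def)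
  moreover have "finite (block b)" using b finite_L by (simp add: block_def)
  ultimately have "card (verts ?C \<inter> block b) = 1"
    using component_Int_block_le_1[OF C, of b]
    by (metis One_nat_def card_gt_0_iff empty_iff finite_Int le_antisym Suc_leI)
  moreover have "card (verts ?C \<inter> block b) \<in> ?M" using C b by blast
  ultimately have "1 \<in> ?M" by simp
  then show ?thesis
    using le unfolding multiplicity_def by (intro Max_eqI) (auto intro: finite_subset)
qed

text \<open>The colour is constant on \<open>C\<close>, so only \<open>H\<close> decides adjacency.
  As the right-hand side does not mention \<open>C\<close>, this yields (b).\<close>

lemma component_dominates_iff:
  assumes C: "C \<in> connected_components G" and v: "v \<in> verts C \<inter> block b" "w \<in> verts C \<inter> block b'"
  shows "v \<rightarrow>\<^bsub>C\<^esub> w \<longleftrightarrow> H b b'"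
proof -
  obtain c c' where eq: "v = node b c" "w = node b' c'"
    using v by (auto simp: block_def)
  have ind: "induced_subgraph C G" by (rule component_induced[OF C])
  have "verts C \<subseteq> verts G" using ind by (auto dest: subgraph_imp_subverts)
  moreover have "c = c'" using component_colour_eq[OF C] v eq by auto
  ultimately show ?thesis
    using v eq induced_subgraph_dominates_iff[OF ind, of v w]
    by (auto simp: node_dominates_iff node_in_verts)
qed

lemma independent_transversal_imp_colouring:
  assumes "independent_transversal G (block ` X) I"
  shows "\<exists>f. (\<forall>b\<in>X. f b \<in> L b) \<and> (\<forall>b\<in>X. \<forall>b'\<in>X. H b b' \<longrightarrow> f b \<noteq> f b')"
proof -
  obtain g where g: "\<And>B. B \<in> block ` X \<Longrightarrow> g B \<in> B" and I: "I = g ` block ` X"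
    and ind: "independent_set G I"
    using assms by (auto simp: independent_transversal_def)
  have "\<exists>c. c \<in> L b \<and> g (block b) = node b c" if "b \<in> X" for b
    using g[of "block b"] that by (auto simp: block_def)
  then obtain f where f: "\<And>b. b \<in> X \<Longrightarrow> f b \<in> L b \<and> g (block b) = node b (f b)"
    by metis
  have "f b \<noteq> f b'" if "b \<in> X" "b' \<in> X" "H b b'" for b b'
  proof
    assume eq: "f b = f b'"
    have "node b (f b) \<rightarrow>\<^bsub>G\<^esub> node b' (f b')"
      using f that eq by (metis node_dominates_iff)
    moreover have "node b (f b) \<in> I" "node b' (f b') \<in> I"
      using f that I by (metis imageI)+
    ultimately show False using ind by (auto simp: independent_set_def)
  qed
  then show ?thesis using f by blast
qed

end

section \<open>Hubs and cells\<close>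

text \<open>\<open>Cell p q t i\<close> is the \<open>i\<close>-th cell of the clique attached to \<open>Hub p q\<close> by the hub's \<open>t\<close>-th
  colour; the cell with \<open>i = d\<close> is the exit. The flag \<open>p\<close> names a pair of hubs, \<open>q\<close> a hub of it.\<close>

datatype block_name = Hub bool bool | Cell bool bool nat nat

datatype colour = Local bool bool nat nat | Exit "bool option"

instance block_name :: countable
  by countable_datatype

instance colour :: countable
  by countable_datatype

text \<open>The first \<open>d\<close> exits of both hubs of a pair share one colour; the last exits
  of all four hubs share \<open>None\<close>.\<close>

definition exit :: "nat \<Rightarrow> bool \<Rightarrow> nat \<Rightarrow> bool option" where
  "exit d p t = (if t < d then Some p else None)"

text \<open>The exits of one colour form a complete bipartite graph, and this names the part: the
  hub within its pair, or the pair itself for last exits.\<close>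

definition side :: "nat \<Rightarrow> bool \<Rightarrow> bool \<Rightarrow> nat \<Rightarrow> bool" where
  "side d p q t = (if t < d then q else p)"

definition blocks :: "nat \<Rightarrow> block_name set" where
  "blocks d = {Hub p q |p q. True} \<union> {Cell p q t i |p q t i. t \<le> d \<and> i \<le> d}"

fun palette :: "nat \<Rightarrow> block_name \<Rightarrow> colour set" where
  "palette d (Hub p q) = (\<lambda>t. Local p q t 0) ` {..d}"
| "palette d (Cell p q t i) =
    (if i < d then Local p q t ` {..d} else insert (Exit (exit d p t)) (Local p q t ` {1..d}))"

text \<open>The last disjunct ignores \<open>i\<close> and \<open>i'\<close>. Joining non-exit cells
  as well is harmless: the cells it joins belong to different hubs, so they share no local
  colour.\<close>

fun adj :: "nat \<Rightarrow> block_name \<Rightarrow> block_name \<Rightarrow> bool" where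
  "adj d (Hub p q) (Hub p' q') \<longleftrightarrow> False"
| "adj d (Hub p q) (Cell p' q' t i) \<longleftrightarrow> p = p' \<and> q = q'"
| "adj d (Cell p' q' t i) (Hub p q) \<longleftrightarrow> p = p' \<and> q = q'"
| "adj d (Cell p q t i) (Cell p' q' t' i') \<longleftrightarrow>
    p = p' \<and> q = q' \<and> t = t' \<and> i \<noteq> i' \<or>
    exit d p t = exit d p' t' \<and> side d p q t \<noteq> side d p' q' t'"

lemma adj_sym: "adj d b b' \<Longrightarrow> adj d b' b"
  by (cases b; cases b') auto

lemma adj_irrefl: "\<not> adj d b b"
  by (cases b) auto

lemma finite_blocks: "finite (blocks d)"
proof -
  have "blocks d = (\<lambda>(p, q). Hub p q) ` UNIV \<union>
      (\<lambda>(p, q, t, i). Cell p q t i) ` (UNIV \<times> UNIV \<times> {..d} \<times> {..d})"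
    by (auto simp: blocks_def image_iff)
  then show ?thesis by simp
qed

lemma finite_palette: "finite (palette d b)"
  by (cases b) auto

lemma card_palette: "card (palette d b) = d + 1"
proof (cases b)
  case Hub
  then show ?thesis by (simp add: card_image inj_on_def)
next
  case (Cell p q t i)
  have "Exit e \<notin> Local p q t ` A" for e A by auto
  then show ?thesis using Cell by (simp add: card_image inj_on_def)
qed

interpretation gadget: list_assignment "blocks d" "palette d" "adj d" for d
  by unfold_locales (simp_all add: finite_blocks finite_palette adj_sym adj_irrefl)

section \<open>Degrees in the gadget\<close>

lemma local_class_subset:
  "\<exists>K. finite K \<and> card K \<le> d + 1 \<and> {b \<in> blocks d. Local p q t k \<in> palette d b} \<subseteq> K"
proof (cases "k = 0")
  case True
  \<comment> \<open>Colour 0 lies on the hub and the \<open>d\<close> non-exit cells; the exit cell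
    has its exit colour instead.\<close>
  let ?K = "insert (Hub p q) (Cell p q t ` {..<d})"
  have "card ?K \<le> d + 1"
    by (rule card_insert_le_m1) (simp_all add: card_image inj_on_def)
  moreover have "{b \<in> blocks d. Local p q t k \<in> palette d b} \<subseteq> ?K"
    using True by (auto simp: blocks_def split: if_splits)
  ultimately show ?thesis by (intro exI[of _ ?K]) simp
next
  case False
  have "{b \<in> blocks d. Local p q t k \<in> palette d b} \<subseteq> Cell p q t ` {..d}"
    using False by (auto simp: blocks_def split: if_splits)
  then show ?thesis
    by (intro exI[of _ "Cell p q t ` {..d}"]) (simp add: card_image inj_on_def)
qed

text \<open>A local colour occurs on at most \<open>d\<close> blocks other than \<open>b\<close>.
  For an exit colour, the neighbours form the opposite part of a complete bipartite graph.\<close>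

lemma card_neighbours_le:
  assumes d: "d \<ge> 2" and b: "b \<in> blocks d" "c \<in> palette d b"
  shows "card {b' \<in> blocks d. adj d b b' \<and> c \<in> palette d b'} \<le> d" (is "card ?N \<le> d")
proof (cases c)
  case (Local p q t k)
  obtain K where K: "finite K" "card K \<le> d + 1" "{b \<in> blocks d. c \<in> palette d b} \<subseteq> K"
    unfolding Local using local_class_subset[of d p q t k] by (elim exE conjE)
  have "?N \<subseteq> K - {b}" using K(3) adj_irrefl by auto
  moreover have "card (K - {b}) \<le> d" using K b by auto
  ultimately show ?thesis using K(1) by (meson card_mono finite_Diff le_trans)
next
  case (Exit e)
  then obtain p q t where bc: "b = Cell p q t d" "t \<le> d" and e: "e = exit d p t"
    using b unfolding Exit by (cases b) (auto simp: blocks_def split: if_splits)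
  show ?thesis
  proof (cases "t < d")
    case True
    have "?N \<subseteq> (\<lambda>t'. Cell p (\<not> q) t' d) ` {..<d}"
      using bc Exit e True by (auto simp: blocks_def exit_def side_def split: if_splits)
    then show ?thesis using surj_card_le[of "{..<d}" ?N] by simp
  next
    case False
    \<comment> \<open>Only the two last exits of the other pair remain, so \<open>d \<ge> 2\<close>
      suffices.\<close>
    have "?N \<subseteq> (\<lambda>q'. Cell (\<not> p) q' d d) ` UNIV"
      using bc Exit e False by (auto simp: blocks_def exit_def side_def split: if_splits)
    then have "card ?N \<le> card (UNIV :: bool set)" by (rule surj_card_le[OF finite_UNIV])
    then show ?thesis using d by simp
  qed
qed

text \<open>Hubs attain the degree bound, through the \<open>d\<close> non-exit cells of one
  clique.\<close>

lemma card_hub_neighbours: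
  assumes "t \<le> d"
  shows "card {b' \<in> blocks d. adj d (Hub p q) b' \<and> Local p q t 0 \<in> palette d b'} = d"
proof -
  have "{b' \<in> blocks d. adj d (Hub p q) b' \<and> Local p q t 0 \<in> palette d b'} = Cell p q t ` {..<d}"
    using assms by (auto simp: blocks_def split: if_splits)
  then show ?thesis by (simp add: card_image inj_on_def)
qed

lemma max_degree_gadget:
  assumes "d \<ge> 2"
  shows "max_degree (gadget.G d) = d"
  unfolding max_degree_def
proof (rule Max_eqI)
  interpret graph "gadget.G d" by (rule gadget.graph_G)
  show "finite (out_degree (gadget.G d) ` verts (gadget.G d))" by simp
  show "x \<le> d" if x: "x \<in> out_degree (gadget.G d) ` verts (gadget.G d)" for x
  proof -
    obtain v where v: "v \<in> verts (gadget.G d)" "x = out_degree (gadget.G d) v"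
      using x by blast
    then obtain b c where "v = gadget.node b c" "b \<in> blocks d" "c \<in> palette d b"
      by (auto simp: gadget.G_def)
    then show ?thesis using v card_neighbours_le[OF assms] by (simp add: gadget.out_degree_node)
  qed
  have b: "Hub True True \<in> blocks d" "Local True True 0 0 \<in> palette d (Hub True True)"
    by (auto simp: blocks_def)
  then show "d \<in> out_degree (gadget.G d) ` verts (gadget.G d)"
    using card_hub_neighbours[of 0 d True True]
    by (intro image_eqI[of _ _ "gadget.node (Hub True True) (Local True True 0 0)"])
      (simp_all add: gadget.out_degree_node gadget.node_in_verts del: palette.simps)
qed

section \<open>Non-colourability of the gadget\<close>

text \<open>A hub using its \<open>t\<close>-th colour leaves only \<open>d\<close> local colours for the \<open>d + 1\<close> cells of its
  \<open>t\<close>-th clique.\<close>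

lemma hub_forces_exit:
  assumes f: "\<And>b. b \<in> blocks d \<Longrightarrow> f b \<in> palette d b"
    and proper: "\<And>b b'. b \<in> blocks d \<Longrightarrow> b' \<in> blocks d \<Longrightarrow> adj d b b' \<Longrightarrow> f b \<noteq> f b'"
    and hub: "f (Hub p q) = Local p q t 0" and t: "t \<le> d"
  shows "f (Cell p q t d) = Exit (exit d p t)"
proof (rule ccontr)
  assume ne: "f (Cell p q t d) \<noteq> Exit (exit d p t)"
  have B: "Hub p q \<in> blocks d" "\<And>i. i \<le> d \<Longrightarrow> Cell p q t i \<in> blocks d"
    using t by (auto simp: blocks_def)
  \<comment> \<open>The range starts at 1: non-exit cells lose colour 0 to the hub, and the exit
    cell does not have it.\<close>
  have "f (Cell p q t i) \<in> Local p q t ` {1..d}" if i: "i \<le> d" for i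
  proof (cases "i = d")
    case True
    then show ?thesis using f[OF B(2)[OF i]] ne by auto
  next
    case False
    moreover have "f (Cell p q t i) \<noteq> Local p q t 0"
      using proper[OF B(1) B(2)[OF i]] hub by simp
    ultimately show ?thesis using f[OF B(2)[OF i]] i by (auto simp: image_iff Suc_le_eq)
  qed
  then have "(\<lambda>i. f (Cell p q t i)) ` {..d} \<subseteq> Local p q t ` {1..d}" by auto
  moreover have "inj_on (\<lambda>i. f (Cell p q t i)) {..d}"
  proof (rule inj_onI, rule ccontr)
    fix i j
    assume "i \<in> {..d}" "j \<in> {..d}" "f (Cell p q t i) = f (Cell p q t j)" "i \<noteq> j"
    then show False using proper[OF B(2) B(2), of i j] by simp
  qed
  ultimately have "card {..d} \<le> card (Local p q t ` {1..d})"
    by (metis card_image card_mono finite_atLeastAtMost finite_imageI)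
  then show False by (simp add: card_image inj_on_def)
qed

lemma gadget_not_colourable:
  assumes f: "\<And>b. b \<in> blocks d \<Longrightarrow> f b \<in> palette d b"
    and proper: "\<And>b b'. b \<in> blocks d \<Longrightarrow> b' \<in> blocks d \<Longrightarrow> adj d b b' \<Longrightarrow> f b \<noteq> f b'"
  shows False
proof -
  have "\<exists>t\<le>d. f (Hub p q) = Local p q t 0" for p q
    using f[of "Hub p q"] by (auto simp: blocks_def)
  then obtain T where T: "\<And>p q. T p q \<le> d" "\<And>p q. f (Hub p q) = Local p q (T p q) 0"
    by metis
  have ex: "f (Cell p q (T p q) d) = Exit (exit d p (T p q))" for p q
    using hub_forces_exit[OF f proper T(2) T(1)] by blast
  have B: "Cell p q (T p q) d \<in> blocks d" for p q
    using T(1) by (auto simp: blocks_def)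
  \<comment> \<open>Exits of equal colour on opposite sides would be adjacent.\<close>
  have same_side: "side d p q (T p q) = side d p' q' (T p' q')"
    if "exit d p (T p q) = exit d p' (T p' q')" for p q p' q'
    using proper[OF B[of p q] B[of p' q']] that ex by auto
  \<comment> \<open>Otherwise both hubs of the pair activate exits coloured \<open>Some p\<close>,
    on opposite sides.\<close>
  have "\<exists>q. \<not> T p q < d" for p
  proof (rule ccontr)
    assume "\<nexists>q. \<not> T p q < d"
    then show False using same_side[of p False p True] by (simp add: exit_def side_def)
  qed
  then obtain q q' where "\<not> T False q < d" "\<not> T True q' < d" by blast
  \<comment> \<open>Both last exits have colour \<open>None\<close>, but their sides are
    \<open>False\<close> and \<open>True\<close>.\<close>
  then show False using same_side[of False q True q'] by (simp add: exit_def side_def)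
qed

theorem mainTheorem4:
  fixes d :: nat
  assumes "d \<ge> 2"
  shows "\<exists>(G :: (nat, nat \<times> nat) pre_digraph) P.
    graph G \<and> partition_on (verts G) P \<and>
    max_degree G = d \<and>
    (\<forall>B\<in>P. card B \<ge> d + 1) \<and>
    \<comment> \<open>(a)\<close>
    (\<forall>C\<in>connected_components G. \<forall>B\<in>P. card (verts C \<inter> B) \<le> 1) \<and>
    multiplicity G P = 1 \<and>
    \<comment> \<open>(b)\<close>
    (\<forall>C\<in>connected_components G. \<forall>C'\<in>connected_components G. \<forall>B\<in>P. \<forall>B'\<in>P.
      \<forall>v \<in> verts C \<inter> B. \<forall>w \<in> verts C \<inter> B'. \<forall>v' \<in> verts C' \<inter> B. \<forall>w' \<in> verts C' \<inter> B'.
        v \<rightarrow>\<^bsub>C\<^esub> w \<longleftrightarrow> v' \<rightarrow>\<^bsub>C'\<^esub> w') \<and>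
    \<not> (\<exists>I. independent_transversal G P I)"
proof (intro exI conjI ballI)
  let ?G = "gadget.G d" and ?P = "gadget.block d ` blocks d"
  show "graph ?G" by (rule gadget.graph_G)
  show "partition_on (verts ?G) ?P"
    by (rule gadget.partition_on_blocks) (metis card.empty card_palette add_is_0 one_neq_zero)
  show "max_degree ?G = d" using assms by (rule max_degree_gadget)
  show "card B \<ge> d + 1" if "B \<in> ?P" for B
    using that by (auto simp: gadget.card_block card_palette)
  show "card (verts C \<inter> B) \<le> 1" if "C \<in> connected_components ?G" "B \<in> ?P" for C B
    using that gadget.component_Int_block_le_1 by blast
  show "multiplicity ?G ?P = 1"
    by (rule gadget.multiplicity_eq_1[of "Hub True True" _ "Local True True 0 0"])
      (auto simp: blocks_def)
  show "\<not> (\<exists>I. independent_transversal ?G ?P I)"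
  proof
    assume "\<exists>I. independent_transversal ?G ?P I"
    then obtain I where "independent_transversal ?G ?P I" ..
    then obtain f where "\<forall>b\<in>blocks d. f b \<in> palette d b"
      and "\<forall>b\<in>blocks d. \<forall>b'\<in>blocks d. adj d b b' \<longrightarrow> f b \<noteq> f b'"
      using gadget.independent_transversal_imp_colouring by blast
    then show False using gadget_not_colourable[of d f] by blast
  qed
  fix C C' B B' v w v' w'
  assume C: "C \<in> connected_components ?G" "C' \<in> connected_components ?G"
    and B: "B \<in> ?P" "B' \<in> ?P"
    and v: "v \<in> verts C \<inter> B" "w \<in> verts C \<inter> B'" "v' \<in> verts C' \<inter> B" "w' \<in> verts C' \<inter> B'"
  obtain b b' where b: "B = gadget.block d b" "B' = gadget.block d b'" using B by blast
  show "v \<rightarrow>\<^bsub>C\<^esub> w \<longleftrightarrow> v' \<rightarrow>\<^bsub>C'\<^esub> w'"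
    using gadget.component_dominates_iff[OF C(1) v(1,2)[unfolded b]]
      gadget.component_dominates_iff[OF C(2) v(3,4)[unfolded b]] by simp
qed

end
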